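(* Let $m$ and $n$ be positive integers such that $m > n$, and let $G$ be Graham's number. Then both $^{m}3 \equiv G \pmod{10^{n-1}}$ and $^{m}3 \not\equiv G \pmod{10^{n}}$ hold if and only if $n = \operatorname{slog}_3(G)$.
   Context: Integer tetration: for positive integers $a,b$, define $^{1}a := a$ and $^{b}a := a^{(^{b-1}a)}$ for $b \ge 2$ (so $^{b}a$ is a power tower of $b$ copies of $a$). Knuth's up-arrow notation, for positive integers $a,b,k$: $a\uparrow^{1} b := a^b$, $a \uparrow^{k+1} 1 := a$, and $a\uparrow^{k+1} b := a \uparrow^{k} (a\uparrow^{k+1}(b-1))$ for $b\ge 2$; thus $a\uparrow^{2} b = {}^{b}a$. Graham's number: $g_1 := 3\uparrow^{4} 3$ and $g_k := 3\uparrow^{g_{k-1}} 3$ for $k\ge 2$; Graham's number is $G := g_{64}$. There is a unique positive integer $N$ with $^{N}3 = G$. Integer super-logarithm in base $3$: $\operatorname{slog}_3(1) := 0$ and $\operatorname{slog}_3(3^q) := \operatorname{slog}_3(q)+1$ for positive integers $q$ for which $\operatorname{slog}_3(q)$ is defined. Hence $\operatorname{slog}_3({}^{k}3) = k$ for every positive integer $k$, and $\operatorname{slog}_3(G)$ is the unique positive integer $N$ with $^{N}3=G$. *)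

theory Defs
  imports "HOL-Number_Theory.Cong"
begin

text \<open>
  All quantities are natural numbers. The functions below are meant for positive arguments; the
  clauses for argument 0 are conventions that only make the functions total.
\<close>

fun tetration :: "nat \<Rightarrow> nat \<Rightarrow> nat" where
  "tetration a 0 = 1"
| "tetration a (Suc 0) = a"
| "tetration a (Suc (Suc b)) = a ^ tetration a (Suc b)"

text \<open>\<open>knuth_arrow a k b\<close> is $a \uparrow^k b$: the number of arrows is the second argument.\<close>

fun knuth_arrow :: "nat \<Rightarrow> nat \<Rightarrow> nat \<Rightarrow> nat" where
  "knuth_arrow a 0 b = a * b"
| "knuth_arrow a (Suc 0) b = a ^ b"
| "knuth_arrow a (Suc (Suc k)) 0 = 1"
| "knuth_arrow a (Suc (Suc k)) (Suc 0) = a"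
| "knuth_arrow a (Suc (Suc k)) (Suc (Suc b)) =
     knuth_arrow a (Suc k) (knuth_arrow a (Suc (Suc k)) (Suc b))"

fun graham_seq :: "nat \<Rightarrow> nat" where
  "graham_seq 0 = 4"
| "graham_seq (Suc 0) = knuth_arrow 3 4 3"
| "graham_seq (Suc (Suc k)) = knuth_arrow 3 (graham_seq (Suc k)) 3"

definition graham_number :: nat where
  "graham_number = graham_seq 64"

text \<open>
  The base-3 super-logarithm is partial, so it is given by its graph: \<open>slog3_graph q s\<close> says that
  the super-logarithm of \<open>q\<close> is defined and equals \<open>s\<close>. No positivity condition on \<open>q\<close> is needed
  in the second rule, as only positive numbers lie in the domain.
\<close>

inductive slog3_graph :: "nat \<Rightarrow> nat \<Rightarrow> bool" where
  one: "slog3_graph 1 0"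
| power: "slog3_graph q s \<Longrightarrow> slog3_graph (3 ^ q) (s + 1)"

definition slog3 :: "nat \<Rightarrow> nat" where
  "slog3 q = (THE s. slog3_graph q s)"

lemma slog3_graph_pos: "slog3_graph q s \<Longrightarrow> 0 < q"
  by (induction rule: slog3_graph.induct) auto

lemma slog3_graph_unique: "slog3_graph q s \<Longrightarrow> slog3_graph q t \<Longrightarrow> s = t"
proof (induction arbitrary: t rule: slog3_graph.induct)
  case one
  from one.prems show ?case
  proof (cases rule: slog3_graph.cases)
    case (power q s)
    have "(1::nat) < 3 ^ q"
      by (rule one_less_power) (use slog3_graph_pos[OF power(3)] in auto)
    with power(1) show ?thesis by linarith
  qed auto
next
  case (power q s)
  have q: "(1::nat) < 3 ^ q"
    by (rule one_less_power) (use slog3_graph_pos[OF power.hyps] in auto)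
  from power.prems show ?case
  proof (cases rule: slog3_graph.cases)
    case one
    with q show ?thesis by linarith
  next
    case (power q' s')
    with \<open>\<And>t. slog3_graph q t \<Longrightarrow> s = t\<close> show ?thesis by simp
  qed
qed

lemma slog3_eqI: "slog3_graph q s \<Longrightarrow> slog3 q = s"
  unfolding slog3_def using slog3_graph_unique by blast

lemma tetration_Suc: "tetration a (Suc b) = a ^ tetration a b"
  by (cases b) auto

lemma slog3_tetration: "slog3 (tetration 3 k) = k"
proof -
  have "slog3_graph (tetration 3 k) k"
  proof (induction k)
    case 0
    then show ?case using slog3_graph.one by simp
  next
    case (Suc k)
    then show ?case using slog3_graph.power[of "tetration 3 k" k] by (simp add: tetration_Suc)
  qed
  then show ?thesis by (rule slog3_eqI)
qed

lemma knuth_arrow_2: "b > 0 \<Longrightarrow> knuth_arrow a 2 b = tetration a b"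
  unfolding numeral_2_eq_2 by (induction a b rule: tetration.induct) auto

lemma knuth_arrow_tower:
  "k \<ge> 2 \<Longrightarrow> b > 0 \<Longrightarrow> \<exists>N>0. knuth_arrow a k b = tetration a N" if "a > 0"
proof (induction k arbitrary: b rule: dec_induct)
  case base
  then show ?case using knuth_arrow_2 by blast
next
  case (step k)
  obtain j where k: "k = Suc j" using step.hyps by (cases k) auto
  have pos: "tetration a N > 0" for N
    by (induction N) (use that in \<open>auto simp: tetration_Suc\<close>)
  show ?case using step.prems
  proof (induction b rule: nat_induct_non_zero)
    case 1
    have "tetration a 1 = a" by simp
    then show ?case unfolding k by fastforce
  next
    case (Suc b)
    obtain c where b: "b = Suc c" using Suc.hyps by (cases b) auto
    have "knuth_arrow a (Suc k) b > 0" using Suc.IH pos by force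
    from step.IH[OF this] show ?case unfolding k b by simp
  qed
qed

lemma graham_number_tower: "\<exists>N>0. graham_number = tetration 3 N"
proof -
  have ge: "tetration 3 N \<ge> 3" if "N > 0" for N
    using that
  proof (induction N rule: nat_induct_non_zero)
    case (Suc N)
    have "(3::nat) ^ 1 \<le> 3 ^ tetration 3 N"
      by (rule power_increasing) (use Suc in auto)
    then show ?case by (simp add: tetration_Suc)
  qed auto
  have "\<exists>N>0. graham_seq (Suc k) = tetration 3 N" for k
  proof (induction k)
    case 0
    have "\<exists>N>0. knuth_arrow 3 4 3 = tetration 3 N"
      by (rule knuth_arrow_tower) auto
    then show ?case by (simp only: graham_seq.simps)
  next
    case (Suc k)
    then obtain N where "N > 0" "graham_seq (Suc k) = tetration 3 N" by blast
    then have "2 \<le> graham_seq (Suc k)" using ge[of N] by linarith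
    then have "\<exists>N>0. knuth_arrow 3 (graham_seq (Suc k)) 3 = tetration 3 N"
      by (intro knuth_arrow_tower) auto
    then show ?case by (simp only: graham_seq.simps)
  qed
  then have "\<exists>N>0. graham_seq (Suc 63) = tetration 3 N" .
  moreover have "Suc 63 = 64" by (simp only: Suc_numeral semiring_norm)
  ultimately show ?thesis
    unfolding graham_number_def by (simp only:)
qed

end

theory Submission
  imports Defs
begin

text \<open>
  Write \<open>T k\<close> for the power tower of \<open>k\<close> threes, so that Graham's number is \<open>T N\<close> with
  \<open>N = slog3 graham_number\<close>. The theorem is about the number of final decimal digits shared by
  \<open>T m\<close> and \<open>T N\<close>. For positive \<open>a < b\<close> this number is exactly \<open>a - 1\<close>, whatever \<open>b\<close> is
  (\<open>tetration_3_cong_iff\<close>).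

  The reason is the recursion \<open>T (b + 1) - T (a + 1) = 3 ^ T a * (3 ^ (T b - T a) - 1)\<close>. If \<open>4\<close>
  divides \<open>x > 0\<close>, then \<open>3 ^ x - 1 = 81 ^ (x div 4) - 1\<close>, and as \<open>81 - 1\<close> contains the prime \<open>5\<close>
  exactly once, lifting the exponent (\<open>multiplicity_power_minus_one\<close>) shows that \<open>3 ^ x - 1\<close>
  contains exactly one factor \<open>5\<close> more than \<open>x\<close>. So every further level of the towers adds exactly
  one factor \<open>5\<close> to the difference, starting from none for \<open>a = 1\<close>. It also adds at least one factor \<open>2\<close>,
  and the factors \<open>2\<close> have a head start; hence the number of factors \<open>10\<close> is the number of factors
  \<open>5\<close>.

  For \<open>m \<noteq> N\<close> the two congruences therefore say \<open>n = min m N\<close>, which for \<open>n < m\<close> means \<open>n = N\<close>.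
  For \<open>m = N\<close> the incongruence fails, and \<open>n < m\<close> excludes \<open>n = N\<close>.
\<close>

section \<open>Lifting the exponent\<close>

text \<open>
  The cofactor in \<open>x ^ y - 1 = (x - 1) * (\<Sum>i<y. x ^ i)\<close> is \<open>y\<close> modulo \<open>p\<close>, since \<open>x\<close> is \<open>1\<close>
  modulo \<open>p\<close>.
\<close>

lemma multiplicity_power_minus_one_coprime:
  fixes x p :: int
  assumes "prime p" and "p dvd x - 1" and "x \<noteq> 1" and "\<not> p dvd int y"
  shows "multiplicity p (x ^ y - 1) = multiplicity p (x - 1)"
proof -
  have "[x = 1] (mod p)"
    using assms(2) by (simp add: cong_iff_dvd_diff)
  then have "[(\<Sum>i<y. x ^ i) = (\<Sum>i<y. 1 ^ i)] (mod p)"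
    by (intro cong_sum cong_pow)
  then have "[(\<Sum>i<y. x ^ i) = int y] (mod p)"
    by simp
  then have nd: "\<not> p dvd (\<Sum>i<y. x ^ i)"
    using assms(4) cong_dvd_iff by blast
  then have "(\<Sum>i<y. x ^ i) \<noteq> 0"
    by auto
  then have "multiplicity p ((x - 1) * (\<Sum>i<y. x ^ i)) = multiplicity p (x - 1)"
    using assms nd by (subst prime_elem_multiplicity_mult_distrib) (auto simp: not_dvd_imp_multiplicity_0)
  then show ?thesis
    by (simp add: power_diff_1_eq)
qed

text \<open>
  Modulo \<open>p\<^sup>2\<close> the cofactor \<open>\<Sum>i<p. x ^ i\<close> is linear in \<open>x - 1\<close>: it equals
  \<open>p + (x - 1) * (p * (p - 1) div 2)\<close>. For odd \<open>p\<close> the second summand vanishes modulo \<open>p\<^sup>2\<close>, so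
  that the cofactor contains the prime \<open>p\<close> exactly once.
\<close>

lemma multiplicity_power_prime_minus_one:
  fixes x :: int and p :: nat
  assumes "prime p" and "odd p" and "int p dvd x - 1" and "x \<noteq> 1"
  shows "multiplicity (int p) (x ^ p - 1) = Suc (multiplicity (int p) (x - 1))"
proof -
  have p0: "int p \<noteq> 0"
    using assms(1) by auto
  obtain w where w: "x = 1 + int p * w"
    using assms(3) by (metis add.commute diff_add_cancel dvd_def)
  have lin: "[x ^ i = 1 + int i * (int p * w)] (mod (int p)\<^sup>2)" for i
  proof (induction i)
    case (Suc i)
    have "[x * x ^ i = x * (1 + int i * (int p * w))] (mod (int p)\<^sup>2)"
      using Suc by (rule cong_scalar_left)
    also have "x * (1 + int i * (int p * w))
        = 1 + int (Suc i) * (int p * w) + (int p)\<^sup>2 * (int i * w\<^sup>2)"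
      by (simp add: w algebra_simps power2_eq_square)
    also have "[\<dots> = 1 + int (Suc i) * (int p * w)] (mod (int p)\<^sup>2)"
      by (simp add: cong_iff_dvd_diff)
    finally show ?case by simp
  qed simp
  obtain h where h: "p = 2 * h + 1"
    using assms(2) by (elim oddE)
  have gauss: "(\<Sum>i<2 * h + 1. int i) = (2 * int h + 1) * int h" for h :: nat
    by (induction h) (simp_all add: algebra_simps)
  have "[(\<Sum>i<p. x ^ i) = (\<Sum>i<p. 1 + int i * (int p * w))] (mod (int p)\<^sup>2)"
    by (intro cong_sum lin)
  also have "(\<Sum>i<p. 1 + int i * (int p * w)) = int p + (\<Sum>i<p. int i) * (int p * w)"
    by (simp add: sum.distrib sum_distrib_right)
  also have "(\<Sum>i<p. int i) = int p * int h"
    using gauss[of h] h by simp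
  also have "[int p + int p * int h * (int p * w) = int p] (mod (int p)\<^sup>2)"
    by (simp add: cong_iff_dvd_diff power2_eq_square)
  finally have "(int p)\<^sup>2 dvd (\<Sum>i<p. x ^ i) - int p"
    by (simp add: cong_iff_dvd_diff)
  then obtain v where "(\<Sum>i<p. x ^ i) - int p = (int p)\<^sup>2 * v" ..
  then have sum: "(\<Sum>i<p. x ^ i) = int p * (1 + int p * v)"
    by (simp add: algebra_simps power2_eq_square)
  have "\<not> int p dvd 1 + int p * v"
    using prime_gt_1_nat[OF assms(1)] by (simp add: dvd_add_left_iff)
  then have m1: "multiplicity (int p) (1 + int p * v) = 0" and nz: "1 + int p * v \<noteq> 0"
    by (auto simp: not_dvd_imp_multiplicity_0)
  have "multiplicity (int p) ((x - 1) * (int p * (1 + int p * v)))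
      = Suc (multiplicity (int p) (x - 1))"
    using assms nz p0 m1 by (simp add: prime_elem_multiplicity_mult_distrib)
  then show ?thesis
    by (simp add: power_diff_1_eq sum)
qed

text \<open>The two lemmas above settle all exponents: split off the factors \<open>p\<close> one at a time.\<close>

lemma multiplicity_power_minus_one:
  fixes x :: int and p :: nat
  assumes "prime p" and "odd p" and "int p dvd x - 1" and "x > 1" and "y > 0"
  shows "multiplicity (int p) (x ^ y - 1) = multiplicity (int p) (x - 1) + multiplicity p y"
  using assms(3-5)
proof (induction y arbitrary: x rule: less_induct)
  case (less y)
  show ?case
  proof (cases "p dvd y")
    case False
    then show ?thesis
      using multiplicity_power_minus_one_coprime[of "int p" x y] less.prems assms(1)
      by (simp add: not_dvd_imp_multiplicity_0)
  next
    case True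
    then obtain z where z: "y = p * z" ..
    have z0: "z > 0" and "z < y"
      using less.prems z prime_gt_1_nat[OF assms(1)] by auto
    have "x - 1 dvd x ^ p - 1"
      by (simp add: power_diff_1_eq)
    with less.prems have d: "int p dvd x ^ p - 1"
      by (blast intro: dvd_trans)
    have x: "x ^ p > 1"
      using less.prems prime_gt_0_nat[OF assms(1)] by (simp add: one_less_power)
    have "multiplicity (int p) ((x ^ p) ^ z - 1)
        = multiplicity (int p) (x ^ p - 1) + multiplicity p z"
      by (rule less.IH[OF \<open>z < y\<close> d x z0])
    moreover have "multiplicity (int p) (x ^ p - 1) = Suc (multiplicity (int p) (x - 1))"
      using less.prems assms by (intro multiplicity_power_prime_minus_one) auto
    moreover have "multiplicity p y = Suc (multiplicity p z)"
      using z z0 assms(1) by (simp add: prime_elem_multiplicity_mult_distrib)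
    ultimately show ?thesis
      by (simp add: z power_mult)
  qed
qed

section \<open>Differences of power towers\<close>

lemma multiplicity_int: "multiplicity (int p) (int x) = multiplicity p x"
  by (simp add: multiplicity_def flip: of_nat_power)

lemma multiplicity_5_power_3_minus_one:
  assumes "4 dvd x" and "x > 0"
  shows "multiplicity 5 ((3::int) ^ x - 1) = Suc (multiplicity 5 x)"
proof -
  obtain y where y: "x = 4 * y"
    using assms(1) ..
  have m80: "multiplicity (5::int) 80 = 1"
    by (rule multiplicity_eqI) auto
  have p5: "prime (5::nat)"
    by simp
  have "multiplicity (5::nat) (4 * y) = multiplicity 5 (4::nat) + multiplicity 5 y"
    using assms y p5 by (intro prime_elem_multiplicity_mult_distrib) auto
  moreover have "multiplicity (5::nat) 4 = 0"
    by (rule not_dvd_imp_multiplicity_0) simp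
  moreover have "multiplicity (int 5) (81 ^ y - 1) = multiplicity (int 5) (81 - 1) + multiplicity 5 y"
    by (rule multiplicity_power_minus_one) (use assms y in auto)
  ultimately show ?thesis
    using m80 by (simp add: y power_mult)
qed

text \<open>
  Doubling the exponent multiplies \<open>3 ^ x - 1\<close> by the even number \<open>3 ^ x + 1\<close>. A lower bound
  on the factors \<open>2\<close> is enough, because the factors \<open>5\<close> are the scarcer ones.
\<close>

lemma power_2_dvd_power_3_minus_one:
  assumes "2 ^ Suc k dvd x"
  shows "2 ^ Suc (Suc k) dvd (3::int) ^ x - 1"
proof -
  have step: "(2::int) ^ Suc (Suc k) dvd 3 ^ 2 ^ Suc k - 1"
  proof (induction k)
    case (Suc k)
    have "(3::int) ^ 2 ^ Suc (Suc k) = (3 ^ 2 ^ Suc k)\<^sup>2"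
      by (simp add: mult.commute flip: power_mult)
    then have "(3::int) ^ 2 ^ Suc (Suc k) - 1 = (3 ^ 2 ^ Suc k - 1) * (3 ^ 2 ^ Suc k + 1)"
      by (simp only: square_diff_one_factored power2_eq_square mult.commute)
    moreover have "(2::int) dvd 3 ^ 2 ^ Suc k + 1"
      by simp
    ultimately show ?case
      using mult_dvd_mono[OF Suc] by (metis mult.commute power_Suc)
  qed simp
  obtain y where y: "x = 2 ^ Suc k * y"
    using assms ..
  have "(3::int) ^ 2 ^ Suc k - 1 dvd (3 ^ 2 ^ Suc k) ^ y - 1"
    by (simp only: power_diff_1_eq dvd_triv_left)
  with step have "2 ^ Suc (Suc k) dvd ((3::int) ^ 2 ^ Suc k) ^ y - 1"
    by (rule dvd_trans)
  then show ?thesis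
    by (simp only: y power_mult)
qed

lemma tetration_3_less_Suc: "tetration 3 k < tetration 3 (Suc k)"
  by (simp add: tetration_Suc power_gt_expt)

lemma strict_mono_tetration_3: "strict_mono (tetration 3)"
  by (rule strict_mono_Suc_iff[THEN iffD2]) (blast intro: tetration_3_less_Suc)

lemma tetration_3_diff_Suc:
  assumes "a \<le> b"
  shows "int (tetration 3 (Suc b)) - int (tetration 3 (Suc a))
      = 3 ^ tetration 3 a * (3 ^ (tetration 3 b - tetration 3 a) - 1)"
proof -
  have "tetration 3 a \<le> tetration 3 b"
    using assms strict_mono_tetration_3 by (simp add: strict_mono_less_eq)
  then show ?thesis
    by (simp add: tetration_Suc algebra_simps flip: power_add)
qed

text \<open>
  The level below the first one is \<open>tetration 3 0 = 1\<close>, so the induction can start with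
  \<open>T (b + 1) - T 1 = 3 * (3 ^ (T b - 1) - 1)\<close>. As \<open>T b\<close> is an odd power of \<open>3\<close>, the exponent
  \<open>T b - 1\<close> is \<open>2\<close> modulo \<open>4\<close>, so that \<open>3 ^ (T b - 1)\<close> is \<open>4\<close> modulo \<open>5\<close>. The divisibility
  by a power of \<open>2\<close> is what makes the exponent a multiple of \<open>4\<close> in all later steps.
\<close>

lemma tetration_3_diff_factors:
  assumes "a < b"
  shows "2 ^ (a + 2) dvd int (tetration 3 (Suc b)) - int (tetration 3 (Suc a))"
    and "multiplicity 5 (int (tetration 3 (Suc b)) - int (tetration 3 (Suc a))) = a"
proof -
  have "2 ^ (a + 2) dvd int (tetration 3 (Suc b)) - int (tetration 3 (Suc a)) \<and>
      multiplicity 5 (int (tetration 3 (Suc b)) - int (tetration 3 (Suc a))) = a"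
    using assms
  proof (induction a arbitrary: b)
    case 0
    then obtain c where b: "b = Suc c"
      by (cases b) auto
    have odd_tower: "odd (tetration 3 k)" for k
      by (induction k) (simp_all add: tetration_Suc)
    obtain d where d: "tetration 3 c = 2 * d + 1"
      using odd_tower by (blast elim: oddE)
    have "[(9::nat) ^ d = 1 ^ d] (mod 4)"
      by (intro cong_pow) (simp add: cong_def)
    then have "[3 * 9 ^ d = 3 * (1::nat)] (mod 4)"
      by (intro cong_scalar_left) simp
    then have "tetration 3 b mod 4 = 3"
      by (simp add: b tetration_Suc d power_add power_mult cong_def)
    then obtain j where j: "tetration 3 b - 1 = 4 * j + 2"
      by (intro that[of "tetration 3 b div 4"]) presburger
    have diff: "int (tetration 3 (Suc b)) - int (tetration 3 (Suc 0)) = 3 * (3 ^ (4 * j + 2) - 1)"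
      using tetration_3_diff_Suc[of 0 b] by (simp only: j tetration.simps(1) power_one_right le0)
    have two: "2 ^ (0 + 2) dvd 3 * ((3::int) ^ (4 * j + 2) - 1)"
      using power_2_dvd_power_3_minus_one[of 0 "4 * j + 2"] by (intro dvd_mult) simp
    have "[(81::int) ^ j = 1 ^ j] (mod 5)"
      by (intro cong_pow) (simp add: cong_def)
    then have "[27 * 81 ^ j - 3 = 27 * 1 - (3::int)] (mod 5)"
      by (intro cong_diff cong_scalar_left) simp_all
    moreover have "3 * ((3::int) ^ (4 * j + 2) - 1) = 27 * 81 ^ j - 3"
      by (simp add: power_add power_mult)
    ultimately have "\<not> 5 dvd 3 * ((3::int) ^ (4 * j + 2) - 1)"
      by (simp add: cong_dvd_iff)
    with two show ?case
      unfolding diff by (blast intro: not_dvd_imp_multiplicity_0)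
  next
    case (Suc a)
    then obtain c where b: "b = Suc c" and "a < c"
      by (cases b) auto
    define x where "x = tetration 3 (Suc c) - tetration 3 (Suc a)"
    have less: "tetration 3 (Suc a) < tetration 3 (Suc c)"
      using \<open>a < c\<close> strict_mono_tetration_3 by (simp only: strict_mono_less Suc_less_eq)
    then have x0: "x > 0" and int_x: "int x = int (tetration 3 (Suc c)) - int (tetration 3 (Suc a))"
      by (auto simp: x_def of_nat_diff)
    have IH: "2 ^ (a + 2) dvd int x" "multiplicity 5 (int x) = a"
      using Suc.IH[OF \<open>a < c\<close>] by (simp_all only: int_x)
    have two_x: "2 ^ Suc (Suc a) dvd x"
      using IH(1) by (simp flip: int_dvd_int_iff)
    have four_x: "4 dvd x"
      using two_x by (auto intro: dvd_trans[rotated])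
    have five_x: "multiplicity 5 x = a"
      using IH(2) multiplicity_int[of 5 x] by simp
    have diff: "int (tetration 3 (Suc b)) - int (tetration 3 (Suc (Suc a)))
        = 3 ^ tetration 3 (Suc a) * (3 ^ x - 1)"
      unfolding b x_def using \<open>a < c\<close> by (intro tetration_3_diff_Suc) simp
    have "2 ^ (Suc a + 2) dvd (3::int) ^ x - 1"
      using power_2_dvd_power_3_minus_one[OF two_x] by simp
    then have two: "2 ^ (Suc a + 2) dvd 3 ^ tetration 3 (Suc a) * ((3::int) ^ x - 1)"
      by (rule dvd_mult)
    have p5: "prime (5::int)"
      by simp
    have "\<not> (5::int) dvd 3 ^ tetration 3 (Suc a)"
      using prime_dvd_power[OF p5, of 3] by auto
    moreover have "(3::int) ^ x - 1 \<noteq> 0"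
      using one_less_power[of "3::int" x] x0 by simp
    ultimately have "multiplicity 5 (3 ^ tetration 3 (Suc a) * ((3::int) ^ x - 1)) = Suc a"
      using multiplicity_5_power_3_minus_one[OF four_x x0] five_x p5
      by (simp add: prime_elem_multiplicity_mult_distrib not_dvd_imp_multiplicity_0)
    with two show ?case
      unfolding diff by blast
  qed
  then show "2 ^ (a + 2) dvd int (tetration 3 (Suc b)) - int (tetration 3 (Suc a))"
    and "multiplicity 5 (int (tetration 3 (Suc b)) - int (tetration 3 (Suc a))) = a"
    by blast+
qed

text \<open>
  The difference has exactly \<open>a - 1\<close> factors \<open>5\<close> and more factors \<open>2\<close> than that, so the
  former alone decide its divisibility by powers of \<open>10\<close>.
\<close>

lemma tetration_3_cong_iff:
  assumes "0 < a" and "a < b"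
  shows "[tetration 3 a = tetration 3 b] (mod 10 ^ k) \<longleftrightarrow> k < a"
proof -
  obtain a' b' where ab: "a = Suc a'" "b = Suc b'" "a' < b'"
    using assms by (cases a; cases b) auto
  define D where "D = int (tetration 3 (Suc b')) - int (tetration 3 (Suc a'))"
  have two: "2 ^ (a' + 2) dvd D" and five: "multiplicity 5 D = a'"
    unfolding D_def using tetration_3_diff_factors[OF ab(3)] by blast+
  have "tetration 3 a < tetration 3 b"
    using assms(2) strict_mono_tetration_3 by (simp only: strict_mono_less)
  then have "D \<noteq> 0"
    by (simp add: D_def ab)
  then have five_iff: "5 ^ k dvd D \<longleftrightarrow> k \<le> a'"
    using five by (simp add: power_dvd_iff_le_multiplicity)
  have ten: "(10::int) ^ k = 2 ^ k * 5 ^ k"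
    by (simp flip: power_mult_distrib)
  have "10 ^ k dvd D \<longleftrightarrow> k \<le> a'"
  proof
    assume "10 ^ k dvd D"
    then show "k \<le> a'"
      using five_iff by (auto simp: ten dest: dvd_mult_right)
  next
    assume "k \<le> a'"
    then have "2 ^ k dvd D"
      using two by (meson dvd_trans le_imp_power_dvd trans_le_add1)
    moreover have "5 ^ k dvd D"
      using five_iff \<open>k \<le> a'\<close> by blast
    moreover have "coprime ((2::int) ^ k) (5 ^ k)"
      by simp
    ultimately show "10 ^ k dvd D"
      unfolding ten by (intro divides_mult)
  qed
  moreover have "[tetration 3 a = tetration 3 b] (mod 10 ^ k)
      \<longleftrightarrow> [int (tetration 3 b) = int (tetration 3 a)] (mod 10 ^ k)"
    by (subst cong_int_iff[symmetric]) (simp add: cong_sym_eq)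
  ultimately show ?thesis
    by (simp add: cong_iff_dvd_diff D_def ab less_Suc_eq_le del: tetration.simps)
qed

section \<open>Graham's number\<close>

theorem theorem2p3:
  fixes m n :: nat
  assumes "m > 0" and "n > 0" and "m > n"
  shows "([tetration 3 m = graham_number] (mod 10 ^ (n - 1)) \<and>
          \<not> [tetration 3 m = graham_number] (mod 10 ^ n))
         \<longleftrightarrow> n = slog3 graham_number"
proof -
  obtain N where "N > 0" and G: "graham_number = tetration 3 N"
    using graham_number_tower by blast
  have slog: "slog3 graham_number = N"
    by (simp only: G slog3_tetration)
  have shared: "[tetration 3 m = tetration 3 N] (mod 10 ^ k) \<longleftrightarrow> m = N \<or> k < min m N" for k
  proof (cases m N rule: linorder_cases)
    case less
    show ?thesis
      unfolding tetration_3_cong_iff[OF assms(1) less] using less by linarith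
  next
    case equal
    show ?thesis
      unfolding equal by (simp only: cong_refl simp_thms)
  next
    case greater
    show ?thesis
      unfolding cong_sym_eq[of "tetration 3 m"] tetration_3_cong_iff[OF \<open>N > 0\<close> greater]
      using greater by linarith
  qed
  show ?thesis
    unfolding slog unfolding G shared using assms by linarith
qed

end
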